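(* If the parameters $q,T$ are fixed, then the average order delay of revised HP1 is the same as that of HP1, and the average order delay of revised TP1 is the same as that of TP1. Moreover, with fixed parameters $q,T$, revised HP1 performs better than QP and revised TP1 in terms of average order delay: $$AOD_{RHP1}<AOD_{QP}\quad\text{and}\quad AOD_{RHP1}<AOD_{RTP1}.$$
   Context: Customer orders arrive according to a Poisson process $\{N(t)\}_{t\ge 0}$ with rate $\lambda>0$ and $N(0)=0$; $\tau_n$ denotes the arrival time of the $n$-th order, and $a\wedge b=\min(a,b)$. A renewal-type clearing policy is specified by its shipment-release time $\tau$ (the length of one consolidation cycle started at time $0$), with $\mathbb{E}[\tau]\in(0,\infty)$, and its average order delay is $AOD_\tau=\mathbb{E}\left[\int_0^\tau N(u)\,du\right]/(\lambda\,\mathbb{E}[\tau])$; a policy performs better than another in terms of average order delay if its average order delay is smaller. The parameters are an integer $q\ge1$ and a real $T>0$. The policies are: QP with parameter $q$: $\tau=\tau_q$; TP1 with parameter $T$: $\tau=T$; HP1 with parameters $q,T$: $\tau=\tau_q\wedge T$. The revised policies do not allow empty shipments. Let $K_T=\min\{k\ge1: N(kT)\ge1\}$. Revised TP1 with parameter $T$ (dispatch at time $T$ if the load is positive; otherwise continue for further periods of length $T$ until the load at the end of a period is positive) has release time $\tau=K_T T$. Revised HP1 with parameters $q,T$ (dispatch when the load reaches $q$ or when $T$ time units have elapsed, whichever is first, except that if the load is zero after $T$ time units no shipment is released and the system restarts) has release time $\tau=\tau_q\wedge(K_T T)$. $AOD_{RHP1}$, $AOD_{RTP1}$, $AOD_{QP}$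 denote the average order delays of revised HP1, revised TP1 and QP with the given parameters.
   Formalization: The inequality AOD_RHP1 < AOD_QP is stated only for q ≥ 2, since for q = 1 both policies release at the first arrival and both average order delays are 0; all other claims are for every q ≥ 1. *)

theory Defs
  imports "HOL-Probability.Probability"
begin

text \<open>
  Time is modelled by the type of reals; \<open>N t\<close> is only constrained for \<open>t \<ge> 0\<close>.
  On naturals the topology is discrete, so right-continuity says that each path is
  locally constant to the right. Unit jumps are not required separately: they follow
  almost surely from the Poisson increments.
\<close>

locale poisson_process = prob_space M
  for M :: "'a measure" and rate :: real and N :: "real \<Rightarrow> 'a \<Rightarrow> nat" +
  assumes rate_pos: "0 < rate"
    and random_variable_count: "0 \<le> t \<Longrightarrow> random_variable (count_space UNIV) (N t)"
    and count_zero: "\<omega> \<in> space M \<Longrightarrow> N 0 \<omega> = 0"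
    and count_mono: "\<lbrakk>\<omega> \<in> space M; 0 \<le> s; s \<le> t\<rbrakk> \<Longrightarrow> N s \<omega> \<le> N t \<omega>"
    and count_right_continuous:
      "\<lbrakk>\<omega> \<in> space M; 0 \<le> t\<rbrakk> \<Longrightarrow> ((\<lambda>s. N s \<omega>) \<longlongrightarrow> N t \<omega>) (at_right t)"
    and indep_increments:
      "\<lbrakk>0 \<le> ts 0; \<And>i. i < n \<Longrightarrow> ts i \<le> ts (Suc i)\<rbrakk> \<Longrightarrow>
        indep_vars (\<lambda>_. count_space UNIV) (\<lambda>i \<omega>. N (ts (Suc i)) \<omega> - N (ts i) \<omega>) {..<n::nat}"
    and poisson_increments:
      "\<lbrakk>0 \<le> s; s < t\<rbrakk> \<Longrightarrow>
        distr M (count_space UNIV) (\<lambda>\<omega>. N t \<omega> - N s \<omega>) = measure_pmf (poisson_pmf (rate * (t - s)))"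

text \<open>
  Arrival time of the \<open>n\<close>-th order. For a Poisson process the set is nonempty almost
  surely; on the remaining null event the value is irrelevant.
\<close>

definition arrival_time :: "(real \<Rightarrow> 'a \<Rightarrow> nat) \<Rightarrow> nat \<Rightarrow> 'a \<Rightarrow> real" where
  "arrival_time N n \<omega> = Inf {t. 0 \<le> t \<and> n \<le> N t \<omega>}"

text \<open>
  The index \<open>K\<^sub>T\<close> of the first period at whose end the load is positive; likewise defined
  up to a null event.
\<close>

definition first_loaded_period :: "(real \<Rightarrow> 'a \<Rightarrow> nat) \<Rightarrow> real \<Rightarrow> 'a \<Rightarrow> nat" where
  "first_loaded_period N T \<omega> = (LEAST k. 1 \<le> k \<and> 1 \<le> N (real k * T) \<omega>)"

definition QP :: "(real \<Rightarrow> 'a \<Rightarrow> nat) \<Rightarrow> nat \<Rightarrow> 'a \<Rightarrow> real" where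
  "QP N q \<omega> = arrival_time N q \<omega>"

definition TP1 :: "real \<Rightarrow> 'a \<Rightarrow> real" where
  "TP1 T \<omega> = T"

definition HP1 :: "(real \<Rightarrow> 'a \<Rightarrow> nat) \<Rightarrow> nat \<Rightarrow> real \<Rightarrow> 'a \<Rightarrow> real" where
  "HP1 N q T \<omega> = min (arrival_time N q \<omega>) T"

definition RTP1 :: "(real \<Rightarrow> 'a \<Rightarrow> nat) \<Rightarrow> real \<Rightarrow> 'a \<Rightarrow> real" where
  "RTP1 N T \<omega> = real (first_loaded_period N T \<omega>) * T"

definition RHP1 :: "(real \<Rightarrow> 'a \<Rightarrow> nat) \<Rightarrow> nat \<Rightarrow> real \<Rightarrow> 'a \<Rightarrow> real" where
  "RHP1 N q T \<omega> = min (arrival_time N q \<omega>) (real (first_loaded_period N T \<omega>) * T)"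

definition clearing_policy :: "'a measure \<Rightarrow> ('a \<Rightarrow> real) \<Rightarrow> bool" where
  "clearing_policy M \<tau> \<longleftrightarrow>
    \<tau> \<in> borel_measurable M \<and> 0 < (\<integral>\<^sup>+\<omega>. ennreal (\<tau> \<omega>) \<partial>M) \<and> (\<integral>\<^sup>+\<omega>. ennreal (\<tau> \<omega>) \<partial>M) < \<infinity>"

text \<open>
  The expectations of the nonnegative quantities are taken in \<open>[0, \<infinity>]\<close>, so no
  integrability side condition is hidden in the numerator; the quotient is meaningful
  whenever \<^term>\<open>clearing_policy M \<tau>\<close> holds.
\<close>

definition AOD :: "'a measure \<Rightarrow> real \<Rightarrow> (real \<Rightarrow> 'a \<Rightarrow> nat) \<Rightarrow> ('a \<Rightarrow> real) \<Rightarrow> ennreal" where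
  "AOD M rate N \<tau> =
    (\<integral>\<^sup>+\<omega>. (\<integral>\<^sup>+u\<in>{0..\<tau> \<omega>}. ennreal (real (N u \<omega>)) \<partial>lborel) \<partial>M) /
    (ennreal rate * (\<integral>\<^sup>+\<omega>. ennreal (\<tau> \<omega>) \<partial>M))"

end

theory Submission
  imports Defs
begin

text \<open>
  Everything reduces to one computation. For a weight \<open>f\<close> on the load, let the cost of a cycle be
  the expectation of \<open>\<integral>\<^sub>0\<^sup>\<tau> f (N u) du\<close>; the average order delay is the cost for \<open>f n = n\<close> divided by
  \<open>rate\<close> times the cost for \<open>f n = 1\<close>. By Tonelli the cost depends only on the survival events
  \<open>u < \<tau>\<close>, and for each of the five policies these can be read off from the counting process: \<open>N u < q\<close>
  for QP, \<open>u < T\<close> for TP1, and both for HP1; the revised policies have, in place of \<open>u < T\<close>, the event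
  that no order came in the periods of length \<open>T\<close> completed by time \<open>u\<close>.

  Equality of the revised and the unrevised policies is a restart argument. The revised cycle can
  outlast \<open>k\<close> periods only if no order came in them, which has probability \<open>exp (- rate * k * T)\<close>, and
  then the process starts afresh. So the revised cost is the unrevised one times
  \<open>\<Sum>k. exp (- rate * k * T)\<close> (lemma \<open>cycle_cost_restart\<close>). This factor does not depend on \<open>f\<close> and
  cancels in the quotient.

  For the inequalities, the expected time spent at load \<open>n\<close> before \<open>T\<close> is \<open>t n / rate\<close>, where
  \<open>t n = P(N T > n)\<close> is an Erlang distribution function in \<open>T\<close>; over the whole half-line it is \<open>1 / rate\<close>.
  Up to the common factor \<open>1 / rate\<close>, the three delays are therefore averages of the load \<open>n\<close>:
  over \<open>n < q\<close> with weights \<open>t n\<close> for HP1, over \<open>n < q\<close> with equal weights for QP, and over all \<open>n\<close>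
  with weights \<open>t n\<close> for TP1. Strictly decreasing weights give a smaller average than equal ones
  (\<open>sum_index_strict_antimono\<close>), and admitting the loads \<open>n \<ge> q\<close>, all of which exceed the average over
  \<open>n < q\<close>, raises it (\<open>AOD_HP1_less_TP1\<close>).
\<close>

section \<open>Averages with decreasing weights\<close>

text \<open>
  A strict Chebyshev sum inequality for the increasing sequence \<open>0, \<dots>, q - 1\<close>: raising \<open>q\<close> by one adds
  \<open>(\<Sum>n<q. t n) - q * t q\<close> to the difference of the two sides, which is nonnegative because \<open>t\<close>
  decreases.
\<close>

lemma sum_index_strict_antimono:
  fixes t :: "nat \<Rightarrow> real"
  assumes t: "\<And>n. t (Suc n) < t n" and q: "2 \<le> q"
  shows "2 * (\<Sum>n<q. real n * t n) < (real q - 1) * (\<Sum>n<q. t n)"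
  using q
proof (induction q rule: dec_induct)
  case base
  show ?case using t[of 0] by (simp add: numeral_2_eq_2)
next
  case (step q)
  have "t q < t n" if "n < q" for n
    using lift_Suc_mono_less[of "\<lambda>n. - t n" n q] t that by simp
  then have "(\<Sum>n<q. t q) \<le> (\<Sum>n<q. t n)"
    by (intro sum_mono) (simp add: less_imp_le)
  with step.IH show ?case by (simp add: algebra_simps)
qed

section \<open>Occupation times of the Poisson process\<close>

lemma emeasure_lborel_atLeast: "emeasure lborel {a::real..} = \<infinity>"
proof (cases "emeasure lborel {a..}")
  case (real r)
  have "emeasure lborel {a..a + (r + 1)} \<le> emeasure lborel {a..}"
    by (intro emeasure_mono) auto
  with real show ?thesis by simp
qed simp

context poisson_process
begin

lemma measurable_count [measurable (raw)]:
  "0 \<le> t \<Longrightarrow> N t \<in> measurable M (count_space UNIV)"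
  by (rule random_variable_count)

text \<open>
  The probability of load \<open>n\<close> at time \<open>u\<close> is written through the Erlang density in \<open>u\<close>, so that its
  time integral is an Erlang distribution function. At \<open>u = 0\<close>, where the Poisson parameter is
  degenerate, the formula holds because \<open>0 ^ 0 = 1\<close>.
\<close>

lemma nn_integral_count:
  assumes u: "0 \<le> u"
  shows "(\<integral>\<^sup>+\<omega>. \<phi> (N u \<omega>) \<partial>M) = (\<Sum>n. \<phi> n * ennreal (erlang_density n rate u / rate))"
proof (cases "u = 0")
  case True
  have "(\<integral>\<^sup>+\<omega>. \<phi> (N u \<omega>) \<partial>M) = (\<integral>\<^sup>+\<omega>. \<phi> 0 \<partial>M)"
    by (intro nn_integral_cong) (simp add: True count_zero)
  also have "\<dots> = \<phi> 0"
    by (simp add: emeasure_space_1)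
  also have "\<dots> = (\<Sum>n. \<phi> n * ennreal (erlang_density n rate u / rate))"
    using rate_pos by (subst suminf_finite[of "{0}"]) (auto simp: True erlang_density_def)
  finally show ?thesis .
next
  case False
  with u have u: "0 < u" by simp
  have "(\<integral>\<^sup>+\<omega>. \<phi> (N u \<omega>) \<partial>M) = (\<integral>\<^sup>+\<omega>. \<phi> (N u \<omega> - N 0 \<omega>) \<partial>M)"
    by (intro nn_integral_cong) (simp add: count_zero)
  also have "\<dots> = (\<integral>\<^sup>+n. \<phi> n \<partial>distr M (count_space UNIV) (\<lambda>\<omega>. N u \<omega> - N 0 \<omega>))"
    using u by (subst nn_integral_distr) auto
  also have "\<dots> = (\<Sum>n. ennreal (pmf (poisson_pmf (rate * u)) n) * \<phi> n)"
    using u by (simp add: poisson_increments nn_integral_measure_pmf nn_integral_count_space_nat del: pmf_poisson)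
  also have "\<dots> = (\<Sum>n. \<phi> n * ennreal (erlang_density n rate u / rate))"
    using u rate_pos
    by (intro suminf_cong) (simp add: erlang_density_def power_mult_distrib mult.commute)
  finally show ?thesis .
qed

lemma nn_integral_occupation:
  assumes I: "I \<in> sets borel" "I \<subseteq> {0..}"
  shows "(\<integral>\<^sup>+u\<in>I. (\<integral>\<^sup>+\<omega>. \<phi> (N u \<omega>) \<partial>M) \<partial>lborel) =
    (\<Sum>n. \<phi> n * (\<integral>\<^sup>+u\<in>I. ennreal (erlang_density n rate u / rate) \<partial>lborel))"
proof -
  have [measurable]: "I \<in> sets lborel" using I by simp
  have "(\<integral>\<^sup>+u\<in>I. (\<integral>\<^sup>+\<omega>. \<phi> (N u \<omega>) \<partial>M) \<partial>lborel) =
      (\<integral>\<^sup>+u. (\<Sum>n. \<phi> n * (ennreal (erlang_density n rate u / rate) * indicator I u)) \<partial>lborel)"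
    using I by (intro nn_integral_cong) (auto simp: nn_integral_count split: split_indicator)
  also have "\<dots> = (\<Sum>n. \<phi> n * (\<integral>\<^sup>+u\<in>I. ennreal (erlang_density n rate u / rate) \<partial>lborel))"
    by (subst nn_integral_suminf) (auto simp: nn_integral_cmult)
  finally show ?thesis .
qed

lemma occupation_time_before:
  "(\<integral>\<^sup>+u\<in>{0..<T}. ennreal (erlang_density n rate u / rate) \<partial>lborel) = ennreal (erlang_CDF n rate T / rate)"
proof -
  have "(\<integral>\<^sup>+u\<in>{0..<T}. ennreal (erlang_density n rate u / rate) \<partial>lborel) =
     (\<integral>\<^sup>+u. ennreal (1 / rate) * (ennreal (erlang_density n rate u) * indicator {..T} u) \<partial>lborel)"
  proof (rule nn_integral_cong_AE)
    show "AE u in lborel. ennreal (erlang_density n rate u / rate) * indicator {0..<T} u =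
        ennreal (1 / rate) * (ennreal (erlang_density n rate u) * indicator {..T} u)"
      using AE_lborel_singleton[of T]
      by eventually_elim
         (use rate_pos in \<open>auto simp: erlang_density_def ennreal_mult[symmetric] split: split_indicator\<close>)
  qed
  also have "\<dots> = ennreal (1 / rate) * ennreal (erlang_CDF n rate T)"
    using rate_pos by (subst nn_integral_cmult) (auto simp: nn_integral_erlang_density)
  also have "\<dots> = ennreal (erlang_CDF n rate T / rate)"
    using rate_pos by (simp add: ennreal_mult[symmetric])
  finally show ?thesis .
qed

lemma occupation_time_total:
  "(\<integral>\<^sup>+u\<in>{0..}. ennreal (erlang_density n rate u / rate) \<partial>lborel) = ennreal (1 / rate)"
proof -
  have "(\<integral>\<^sup>+u\<in>{0..}. ennreal (erlang_density n rate u / rate) \<partial>lborel) =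
     (\<integral>\<^sup>+u. ennreal (1 / rate) * ennreal (erlang_density n rate u * u ^ 0) \<partial>lborel)"
    using rate_pos
    by (intro nn_integral_cong)
       (auto simp: erlang_density_def ennreal_mult[symmetric] split: split_indicator)
  also have "\<dots> = ennreal (1 / rate)"
    using rate_pos by (subst nn_integral_cmult, simp, subst nn_integral_erlang_ith_moment) (auto simp: ennreal_1)
  finally show ?thesis .
qed

text \<open>
  If the paths bounded by \<open>n\<close> had positive probability, the expected time spent at loads below \<open>n\<close> would
  be infinite, but it is \<open>n / rate\<close>.
\<close>

lemma AE_count_unbounded: "AE \<omega> in M. \<forall>n. \<exists>k::nat. n \<le> N (real k) \<omega>"
proof (subst AE_all_countable, rule allI)
  fix n
  define B where "B = {\<omega>\<in>space M. \<forall>k::nat. N (real k) \<omega> < n}"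
  have [measurable]: "B \<in> sets M" unfolding B_def by measurable
  have le: "indicator B \<omega> \<le> (indicator {..<n} (N u \<omega>) :: ennreal)" if "0 \<le> u" "\<omega> \<in> space M" for u \<omega>
  proof (cases "\<omega> \<in> B")
    case True
    have "N u \<omega> \<le> N (real (nat \<lceil>u\<rceil>)) \<omega>"
      using that by (intro count_mono) linarith+
    also have "\<dots> < n" using True by (simp add: B_def)
    finally show ?thesis by (simp split: split_indicator)
  qed simp
  have "\<infinity> * emeasure M B = (\<integral>\<^sup>+u\<in>{0::real..}. emeasure M B \<partial>lborel)"
    by (subst nn_integral_cmult) (auto simp: mult.commute emeasure_lborel_atLeast)
  also have "\<dots> \<le> (\<integral>\<^sup>+u\<in>{0..}. (\<integral>\<^sup>+\<omega>. indicator {..<n} (N u \<omega>) \<partial>M) \<partial>lborel)"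
    by (intro nn_integral_mono)
       (auto split: split_indicator simp flip: nn_integral_indicator intro!: nn_integral_mono le)
  also have "\<dots> = (\<Sum>m. indicator {..<n} m * ennreal (1 / rate))"
    by (subst nn_integral_occupation) (auto simp: occupation_time_total)
  also have "\<dots> = (\<Sum>m<n. ennreal (1 / rate))"
    by (subst suminf_finite[of "{..<n}"]) auto
  also have "\<dots> < \<infinity>"
    by (simp add: ennreal_mult_less_top of_nat_less_top)
  finally have "emeasure M B = 0"
    by (auto simp: ennreal_top_mult split: if_splits)
  then show "AE \<omega> in M. \<exists>k::nat. n \<le> N (real k) \<omega>"
    by (intro AE_I'[of B]) (auto simp: B_def not_le null_sets_def \<open>B \<in> sets M\<close>[unfolded B_def])
qed

section \<open>Arrival times and joint measurability\<close>

text \<open>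
  The infimum defining the arrival time is attained: by right-continuity the path is constant on
  some interval starting at the infimum, and this interval meets the set. The hypothesis on \<open>k\<close> excludes the infimum of the empty
  set.
\<close>

lemma arrival_time_le_iff:
  assumes \<omega>: "\<omega> \<in> space M" and u: "0 \<le> u" and k: "n \<le> N (real k) \<omega>"
  shows "arrival_time N n \<omega> \<le> u \<longleftrightarrow> n \<le> N u \<omega>"
proof
  let ?S = "{t. 0 \<le> t \<and> n \<le> N t \<omega>}" and ?a = "arrival_time N n \<omega>"
  have bdd: "bdd_below ?S" by (auto intro: bdd_belowI[of _ 0])
  have ne: "?S \<noteq> {}" using k by (auto intro!: exI[of _ "real k"])
  have a: "0 \<le> ?a" unfolding arrival_time_def by (intro cInf_greatest ne) auto
  show "?a \<le> u" if "n \<le> N u \<omega>"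
    unfolding arrival_time_def using u that by (intro cInf_lower bdd) auto
  assume le: "?a \<le> u"
  have "eventually (\<lambda>s. N s \<omega> = N ?a \<omega>) (at_right ?a)"
    using count_right_continuous[OF \<omega> a] by (simp add: tendsto_discrete)
  then obtain b where b: "?a < b" "\<And>s. ?a < s \<Longrightarrow> s < b \<Longrightarrow> N s \<omega> = N ?a \<omega>"
    by (auto simp: eventually_at_right_field)
  obtain t where t: "0 \<le> t" "n \<le> N t \<omega>" "t < b"
    using cInf_lessD[OF ne, of b] b(1) unfolding arrival_time_def by auto
  have "?a \<le> t" unfolding arrival_time_def using t by (intro cInf_lower bdd) auto
  then have "n \<le> N ?a \<omega>" using b(2)[of t] t by (cases "t = ?a") auto
  also have "\<dots> \<le> N u \<omega>" by (intro count_mono \<omega> a le)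
  finally show "n \<le> N u \<omega>" .
qed

text \<open>
  Measurability is needed on all of the space, including the null event of bounded paths, where the
  arrival time is the constant \<open>Inf {}\<close>.
\<close>

lemma measurable_arrival_time [measurable]: "arrival_time N n \<in> borel_measurable M"
proof (subst borel_measurable_iff_le, rule allI)
  fix a
  let ?c = "Inf {} :: real"
  have eq: "{\<omega>\<in>space M. arrival_time N n \<omega> \<le> a} =
    {\<omega>\<in>space M. (\<exists>k::nat. n \<le> N (real k) \<omega>) \<and> 0 \<le> a \<and> n \<le> N (max 0 a) \<omega> \<or>
      \<not> (\<exists>k::nat. n \<le> N (real k) \<omega>) \<and> ?c \<le> a}"
  proof (intro Collect_cong conj_cong refl)
    fix \<omega> assume \<omega>: "\<omega> \<in> space M"
    show "arrival_time N n \<omega> \<le> a \<longleftrightarrow> ((\<exists>k::nat. n \<le> N (real k) \<omega>) \<and> 0 \<le> a \<and> n \<le> N (max 0 a) \<omega> \<or>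
      \<not> (\<exists>k::nat. n \<le> N (real k) \<omega>) \<and> ?c \<le> a)"
    proof (cases "\<exists>k::nat. n \<le> N (real k) \<omega>")
      case True
      then obtain k :: nat where k: "n \<le> N (real k) \<omega>" ..
      have "0 \<le> arrival_time N n \<omega>" unfolding arrival_time_def
        using k by (intro cInf_greatest) (auto intro!: exI[of _ "real k"])
      with True arrival_time_le_iff[OF \<omega> _ k, of a] show ?thesis by (auto simp: max_def)
    next
      case False
      have "{t. 0 \<le> t \<and> n \<le> N t \<omega>} = {}"
      proof safe
        fix t assume "0 \<le> t" "n \<le> N t \<omega>"
        moreover have "N t \<omega> \<le> N (real (nat \<lceil>t\<rceil>)) \<omega>"
          using \<omega> \<open>0 \<le> t\<close> by (intro count_mono) linarith+
        ultimately show "t \<in> {}" using False by (meson le_trans)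
      qed
      then have "arrival_time N n \<omega> = ?c" by (simp only: arrival_time_def)
      with False show ?thesis by simp
    qed
  qed
  show "{\<omega>\<in>space M. arrival_time N n \<omega> \<le> a} \<in> sets M"
    unfolding eq by measurable
qed

text \<open>
  Tonelli needs the count to be measurable jointly in time and outcome. The set where the count is
  at least \<open>n\<close> is the set above the graph of the \<open>n\<close>-th arrival time, without the paths that never reach \<open>n\<close>. The maximum with \<open>0\<close> is there
  because negative times are unconstrained.
\<close>

lemma measurable_count_pair [measurable]:
  "(\<lambda>(u, \<omega>). N (max 0 u) \<omega>) \<in> measurable (lborel \<Otimes>\<^sub>M M) (count_space UNIV)"
proof -
  have ge: "{x \<in> space (lborel \<Otimes>\<^sub>M M). n \<le> N (max 0 (fst x)) (snd x)} \<in> sets (lborel \<Otimes>\<^sub>M M)" for n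
  proof -
    have "{x \<in> space (lborel \<Otimes>\<^sub>M M). n \<le> N (max 0 (fst x)) (snd x)} =
      {x \<in> space (lborel \<Otimes>\<^sub>M M). (\<exists>k::nat. n \<le> N (real k) (snd x)) \<and> arrival_time N n (snd x) \<le> max 0 (fst x)}"
    proof (intro Collect_cong conj_cong refl)
      fix x :: "real \<times> 'a" assume "x \<in> space (lborel \<Otimes>\<^sub>M M)"
      then have x: "snd x \<in> space M" by (auto simp: space_pair_measure)
      have "\<exists>k::nat. n \<le> N (real k) (snd x)" if "n \<le> N (max 0 (fst x)) (snd x)"
      proof -
        have "N (max 0 (fst x)) (snd x) \<le> N (real (nat \<lceil>max 0 (fst x)\<rceil>)) (snd x)"
          using x by (intro count_mono) linarith+
        with that show ?thesis by (meson le_trans)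
      qed
      then show "n \<le> N (max 0 (fst x)) (snd x) \<longleftrightarrow>
        (\<exists>k::nat. n \<le> N (real k) (snd x)) \<and> arrival_time N n (snd x) \<le> max 0 (fst x)"
        using arrival_time_le_iff[OF x, of "max 0 (fst x)"] by auto
    qed
    also have "\<dots> \<in> sets (lborel \<Otimes>\<^sub>M M)"
    proof -
      have [measurable]: "(\<lambda>x. N (real k) (snd x)) \<in> measurable (lborel \<Otimes>\<^sub>M M) (count_space UNIV)" for k :: nat
        by (rule measurable_compose[OF measurable_snd measurable_count]) simp
      have [measurable]: "(\<lambda>x. arrival_time N n (snd x)) \<in> borel_measurable (lborel \<Otimes>\<^sub>M M)"
        by (rule measurable_compose[OF measurable_snd measurable_arrival_time])
      have [measurable]: "fst \<in> borel_measurable (lborel \<Otimes>\<^sub>M M)"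
        by (rule measurable_compose[OF measurable_fst[of lborel]]) simp
      show ?thesis by measurable
    qed
    finally show ?thesis .
  qed
  have "(\<lambda>(u, \<omega>). N (max 0 u) \<omega>) -` {n} \<inter> space (lborel \<Otimes>\<^sub>M M) =
      {x \<in> space (lborel \<Otimes>\<^sub>M M). n \<le> N (max 0 (fst x)) (snd x)} -
      {x \<in> space (lborel \<Otimes>\<^sub>M M). Suc n \<le> N (max 0 (fst x)) (snd x)}" for n
    by (auto simp: case_prod_beta)
  with ge show ?thesis
    by (subst measurable_count_space_eq2_countable) auto
qed

section \<open>The cost of a cycle\<close>

definition cycle_cost :: "(nat \<Rightarrow> ennreal) \<Rightarrow> ('a \<Rightarrow> real) \<Rightarrow> ennreal" where
  "cycle_cost f \<tau> = (\<integral>\<^sup>+\<omega>. (\<integral>\<^sup>+u\<in>{0..\<tau> \<omega>}. f (N u \<omega>) \<partial>lborel) \<partial>M)"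

text \<open>
  This is Tonelli's theorem; the closed interval up to \<open>\<tau>\<close> may be replaced by the half-open one, as one
  point has Lebesgue measure zero.
\<close>

lemma cycle_cost_survival:
  assumes [measurable]: "\<tau> \<in> borel_measurable M"
    and S: "AE \<omega> in M. \<forall>u\<ge>0. u < \<tau> \<omega> \<longleftrightarrow> S u \<omega>"
  shows "cycle_cost f \<tau> = (\<integral>\<^sup>+u\<in>{0..}. (\<integral>\<^sup>+\<omega>\<in>{\<omega>. S u \<omega>}. f (N u \<omega>) \<partial>M) \<partial>lborel)"
proof -
  interpret P: pair_sigma_finite lborel M
    by (simp add: pair_sigma_finite_def sigma_finite_measure_axioms sigma_finite_lborel)
  define g where "g = (\<lambda>u \<omega>. f (N (max 0 u) \<omega>) * indicator {0..<\<tau> \<omega>} u)"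
  define A where "A = {x \<in> space (lborel \<Otimes>\<^sub>M M). 0 \<le> fst x \<and> fst x < \<tau> (snd x)}"
  have [measurable]: "(\<lambda>x. \<tau> (snd x)) \<in> borel_measurable (lborel \<Otimes>\<^sub>M M)"
    by (rule measurable_compose[OF measurable_snd assms(1)])
  have [measurable]: "fst \<in> borel_measurable (lborel \<Otimes>\<^sub>M M)"
    by (rule measurable_compose[OF measurable_fst[of lborel]]) simp
  have A: "A \<in> sets (lborel \<Otimes>\<^sub>M M)"
    unfolding A_def by measurable
  have f: "(\<lambda>x. f (case x of (u, \<omega>) \<Rightarrow> N (max 0 u) \<omega>)) \<in> borel_measurable (lborel \<Otimes>\<^sub>M M)"
    by (rule measurable_compose[OF measurable_count_pair]) simp
  have "(\<lambda>x. f (case x of (u, \<omega>) \<Rightarrow> N (max 0 u) \<omega>) * indicator A x) \<in> borel_measurable (lborel \<Otimes>\<^sub>M M)"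
    by (intro borel_measurable_times_ennreal f borel_measurable_indicator A)
  also have "?this \<longleftrightarrow> case_prod g \<in> borel_measurable (lborel \<Otimes>\<^sub>M M)"
    by (intro measurable_cong) (auto simp: g_def A_def split: split_indicator)
  finally have g: "case_prod g \<in> borel_measurable (lborel \<Otimes>\<^sub>M M)" .
  have "cycle_cost f \<tau> = (\<integral>\<^sup>+\<omega>. (\<integral>\<^sup>+u. g u \<omega> \<partial>lborel) \<partial>M)"
    unfolding cycle_cost_def
  proof (rule nn_integral_cong)
    fix \<omega>
    show "(\<integral>\<^sup>+u\<in>{0..\<tau> \<omega>}. f (N u \<omega>) \<partial>lborel) = (\<integral>\<^sup>+u. g u \<omega> \<partial>lborel)"
    proof (rule nn_integral_cong_AE)
      show "AE u in lborel. f (N u \<omega>) * indicator {0..\<tau> \<omega>} u = g u \<omega>"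
        using AE_lborel_singleton[of "\<tau> \<omega>"]
        by eventually_elim (auto simp: g_def split: split_indicator)
    qed
  qed
  also have "\<dots> = (\<integral>\<^sup>+u. (\<integral>\<^sup>+\<omega>. g u \<omega> \<partial>M) \<partial>lborel)"
    by (rule P.Fubini'[OF g])
  also have "\<dots> = (\<integral>\<^sup>+u\<in>{0..}. (\<integral>\<^sup>+\<omega>\<in>{\<omega>. S u \<omega>}. f (N u \<omega>) \<partial>M) \<partial>lborel)"
  proof (rule nn_integral_cong)
    fix u :: real
    show "(\<integral>\<^sup>+\<omega>. g u \<omega> \<partial>M) = (\<integral>\<^sup>+\<omega>\<in>{\<omega>. S u \<omega>}. f (N u \<omega>) \<partial>M) * indicator {0..} u"
    proof (cases "0 \<le> u")
      case True
      have "(\<integral>\<^sup>+\<omega>. g u \<omega> \<partial>M) = (\<integral>\<^sup>+\<omega>\<in>{\<omega>. S u \<omega>}. f (N u \<omega>) \<partial>M)"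
      proof (rule nn_integral_cong_AE)
        show "AE \<omega> in M. g u \<omega> = f (N u \<omega>) * indicator {\<omega>. S u \<omega>} \<omega>"
          using S by eventually_elim (auto simp: g_def True split: split_indicator)
      qed
      with True show ?thesis by simp
    qed (simp add: g_def)
  qed
  finally show ?thesis .
qed

text \<open>
  For a cycle whose survival at time \<open>u\<close> depends on \<open>u\<close> and on the load at \<open>u\<close> alone, the cost is a sum
  over the loads, weighted by the expected times spent there.
\<close>

lemma cycle_cost_occupation:
  assumes \<tau>: "\<tau> \<in> borel_measurable M"
    and I: "I \<in> sets borel" "I \<subseteq> {0..}"
    and S: "AE \<omega> in M. \<forall>u\<ge>0. u < \<tau> \<omega> \<longleftrightarrow> u \<in> I \<and> N u \<omega> \<in> A"
  shows "cycle_cost f \<tau> =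
    (\<Sum>n. f n * indicator A n * (\<integral>\<^sup>+u\<in>I. ennreal (erlang_density n rate u / rate) \<partial>lborel))"
proof -
  have "cycle_cost f \<tau> = (\<integral>\<^sup>+u\<in>I. (\<integral>\<^sup>+\<omega>. f (N u \<omega>) * indicator A (N u \<omega>) \<partial>M) \<partial>lborel)"
    unfolding cycle_cost_survival[OF \<tau> S] using I(2)
    by (intro nn_integral_cong) (auto split: split_indicator intro!: nn_integral_cong)
  also have "\<dots> = (\<Sum>n. f n * indicator A n * (\<integral>\<^sup>+u\<in>I. ennreal (erlang_density n rate u / rate) \<partial>lborel))"
    by (rule nn_integral_occupation[OF I])
  finally show ?thesis .
qed

section \<open>Restarting after empty periods\<close>

lemma nn_integral_increment:
  assumes "0 \<le> s" "s \<le> t"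
  shows "(\<integral>\<^sup>+\<omega>. \<phi> (N t \<omega> - N s \<omega>) \<partial>M) = (\<integral>\<^sup>+\<omega>. \<phi> (N (t - s) \<omega>) \<partial>M)"
proof (cases "s = t")
  case True
  then show ?thesis by (intro nn_integral_cong) (simp add: count_zero)
next
  case False
  with assms have st: "0 \<le> s" "s < t" by auto
  have "(\<integral>\<^sup>+\<omega>. \<phi> (N t \<omega> - N s \<omega>) \<partial>M) =
      (\<integral>\<^sup>+n. \<phi> n \<partial>distr M (count_space UNIV) (\<lambda>\<omega>. N t \<omega> - N s \<omega>))"
    using st by (subst nn_integral_distr) auto
  also have "distr M (count_space UNIV) (\<lambda>\<omega>. N t \<omega> - N s \<omega>) =
      distr M (count_space UNIV) (\<lambda>\<omega>. N (t - s) \<omega> - N 0 \<omega>)"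
    using st by (simp add: poisson_increments)
  also have "(\<integral>\<^sup>+n. \<phi> n \<partial>distr M (count_space UNIV) (\<lambda>\<omega>. N (t - s) \<omega> - N 0 \<omega>)) =
      (\<integral>\<^sup>+\<omega>. \<phi> (N (t - s) \<omega> - N 0 \<omega>) \<partial>M)"
    using st by (subst nn_integral_distr) auto
  also have "\<dots> = (\<integral>\<^sup>+\<omega>. \<phi> (N (t - s) \<omega>) \<partial>M)"
    by (intro nn_integral_cong) (simp add: count_zero)
  finally show ?thesis .
qed

text \<open>
  On the event that no order came up to \<open>s\<close>, the load at \<open>t\<close> is the increment over \<open>[s, t]\<close>, which is
  independent of that event and distributed as the load at \<open>t - s\<close>.
\<close>

lemma nn_integral_restart:
  assumes st: "0 \<le> s" "s \<le> t"
  shows "(\<integral>\<^sup>+\<omega>\<in>{\<omega>. N s \<omega> = 0}. \<phi> (N t \<omega>) \<partial>M) =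
    ennreal (exp (- (rate * s))) * (\<integral>\<^sup>+\<omega>. \<phi> (N (t - s) \<omega>) \<partial>M)"
proof -
  \<comment> \<open>The grid \<open>0 \<le> s \<le> t\<close>: its first increment carries the event, its second one the load.\<close>
  define ts where "ts = (\<lambda>i::nat. if i = 0 then 0 else if i = 1 then s else t)"
  define Y :: "nat \<Rightarrow> nat \<Rightarrow> ennreal" where "Y = (\<lambda>i. if i = 0 then indicator {0} else \<phi>)"
  have ind: "indep_vars (\<lambda>_. count_space UNIV) (\<lambda>i \<omega>. N (ts (Suc i)) \<omega> - N (ts i) \<omega>) {..<2}"
    using st by (intro indep_increments) (auto simp: ts_def)
  have "(\<integral>\<^sup>+\<omega>\<in>{\<omega>. N s \<omega> = 0}. \<phi> (N t \<omega>) \<partial>M) =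
      (\<integral>\<^sup>+\<omega>. (\<Prod>i<2. Y i (N (ts (Suc i)) \<omega> - N (ts i) \<omega>)) \<partial>M)"
    by (intro nn_integral_cong)
       (auto simp: numeral_2_eq_2 Y_def ts_def count_zero split: split_indicator)
  also have "\<dots> = (\<Prod>i<2. \<integral>\<^sup>+\<omega>. Y i (N (ts (Suc i)) \<omega> - N (ts i) \<omega>) \<partial>M)"
    by (intro indep_vars_nn_integral indep_vars_compose2[OF ind]) auto
  also have "\<dots> = (\<integral>\<^sup>+\<omega>. indicator {0} (N s \<omega> - N 0 \<omega>) \<partial>M) * (\<integral>\<^sup>+\<omega>. \<phi> (N t \<omega> - N s \<omega>) \<partial>M)"
    by (simp add: numeral_2_eq_2 Y_def ts_def)
  also have "(\<integral>\<^sup>+\<omega>. \<phi> (N t \<omega> - N s \<omega>) \<partial>M) = (\<integral>\<^sup>+\<omega>. \<phi> (N (t - s) \<omega>) \<partial>M)"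
    by (rule nn_integral_increment[OF st])
  also have "(\<integral>\<^sup>+\<omega>. indicator {0} (N s \<omega> - N 0 \<omega>) \<partial>M) = (\<integral>\<^sup>+\<omega>. indicator {0} (N s \<omega>) \<partial>M)"
    using nn_integral_increment[of 0 s "indicator {0}"] st by simp
  also have "\<dots> = ennreal (exp (- (rate * s)))"
    using st rate_pos
    by (subst nn_integral_count, simp, subst suminf_finite[of "{0}"]) (auto simp: erlang_density_def)
  finally show ?thesis .
qed

text \<open>
  The half-line is cut into the periods \<open>[k T, k T + T)\<close>. In the \<open>k\<close>-th one the integrand is, by the
  restart property, \<open>exp (- rate * k * T)\<close> times the integrand of the unrevised policy shifted by \<open>k T\<close>.
\<close>

lemma cycle_cost_restart:
  assumes T: "0 < T"
    and \<tau>: "\<tau> \<in> borel_measurable M" and \<tau>': "\<tau>' \<in> borel_measurable M"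
    and S: "AE \<omega> in M. \<forall>u\<ge>0. u < \<tau> \<omega> \<longleftrightarrow> u < T \<and> N u \<omega> \<in> A"
    and S': "AE \<omega> in M. \<forall>u\<ge>0. u < \<tau>' \<omega> \<longleftrightarrow> N (real (nat \<lfloor>u / T\<rfloor>) * T) \<omega> = 0 \<and> N u \<omega> \<in> A"
  shows "cycle_cost f \<tau>' = (\<Sum>k. ennreal (exp (- (rate * (real k * T))))) * cycle_cost f \<tau>"
proof -
  define G where "G u = (\<Sum>n. f n * indicator A n * ennreal (erlang_density n rate u / rate))" for u
  have [measurable]: "G \<in> borel_measurable borel" unfolding G_def by measurable
  have G: "(\<integral>\<^sup>+\<omega>. f (N u \<omega>) * indicator A (N u \<omega>) \<partial>M) = G u" if "0 \<le> u" for u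
    unfolding G_def using that by (rule nn_integral_count)
  have cost: "cycle_cost f \<tau> = (\<integral>\<^sup>+u\<in>{0..<T}. G u \<partial>lborel)"
    unfolding cycle_cost_survival[OF \<tau> S]
    by (intro nn_integral_cong) (auto simp flip: G split: split_indicator intro!: nn_integral_cong)
  \<comment> \<open>\<open>G\<close> is the cost rate of the unrevised policy at \<open>u < T\<close>, and \<open>F\<close> that of the revised one.\<close>
  define F where "F u = (\<integral>\<^sup>+\<omega>\<in>{\<omega>. N (real (nat \<lfloor>u / T\<rfloor>) * T) \<omega> = 0 \<and> N u \<omega> \<in> A}. f (N u \<omega>) \<partial>M)" for u
  let ?P = "\<lambda>k::nat. {real k * T..<real k * T + T}" and ?e = "\<lambda>k. ennreal (exp (- (rate * (real k * T))))"
  have period: "u \<in> ?P k \<longleftrightarrow> 0 \<le> u \<and> nat \<lfloor>u / T\<rfloor> = k" for u k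
  proof -
    have "u \<in> ?P k \<longleftrightarrow> \<lfloor>u / T\<rfloor> = int k"
      using T by (simp add: floor_eq_iff field_simps)
    moreover have "0 \<le> u \<longleftrightarrow> 0 \<le> \<lfloor>u / T\<rfloor>" using T by (simp add: zero_le_divide_iff)
    moreover have "z = int k \<longleftrightarrow> 0 \<le> z \<and> nat z = k" for z by auto
    ultimately show ?thesis by metis
  qed
  have F: "F u = ?e k * G (u - real k * T)" if u: "u \<in> ?P k" for u k
  proof -
    from u have k: "nat \<lfloor>u / T\<rfloor> = k" unfolding period by simp
    have "F u = (\<integral>\<^sup>+\<omega>\<in>{\<omega>. N (real k * T) \<omega> = 0}. f (N u \<omega>) * indicator A (N u \<omega>) \<partial>M)"
      unfolding F_def k by (intro nn_integral_cong) (auto split: split_indicator)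
    also have "\<dots> = ?e k * G (u - real k * T)"
      using u T by (subst nn_integral_restart) (auto simp: G)
    finally show ?thesis .
  qed
  have "cycle_cost f \<tau>' = (\<integral>\<^sup>+u\<in>{0..}. F u \<partial>lborel)"
    unfolding cycle_cost_survival[OF \<tau>' S'] F_def ..
  also have "\<dots> = (\<integral>\<^sup>+u. (\<Sum>k. ?e k * (G (u - real k * T) * indicator {0..<T} (u - real k * T))) \<partial>lborel)"
  proof (rule nn_integral_cong)
    fix u
    let ?g = "\<lambda>k. ?e k * (G (u - real k * T) * indicator {0..<T} (u - real k * T))"
    have ind: "indicator {0..<T} (u - real k * T) = (indicator (?P k) u :: ennreal)" for k
      by (auto split: split_indicator)
    show "F u * indicator {0..} u = (\<Sum>k. ?g k)"
    proof (cases "0 \<le> u")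
      case True
      define k where "k = nat \<lfloor>u / T\<rfloor>"
      have k: "u \<in> ?P j \<longleftrightarrow> j = k" for j
        using True unfolding period k_def by auto
      have "(\<Sum>k. ?g k) = (\<Sum>j\<in>{k}. ?g j)"
        using k by (intro suminf_finite) (auto simp: ind simp del: atLeastLessThan_iff)
      with True F[of u k] k show ?thesis by (simp add: ind del: atLeastLessThan_iff)
    next
      case False
      then show ?thesis using period[of u] by (simp add: ind del: atLeastLessThan_iff)
    qed
  qed
  also have "\<dots> = (\<Sum>k. ?e k * (\<integral>\<^sup>+u. G (u - real k * T) * indicator {0..<T} (u - real k * T) \<partial>lborel))"
    by (subst nn_integral_suminf, measurable, subst nn_integral_cmult) auto
  also have "\<dots> = (\<Sum>k. ?e k * cycle_cost f \<tau>)"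
  proof (intro suminf_cong arg_cong2[of _ _ _ _ "(*)"] refl)
    fix k :: nat
    show "(\<integral>\<^sup>+u. G (u - real k * T) * indicator {0..<T} (u - real k * T) \<partial>lborel) = cycle_cost f \<tau>"
      unfolding cost
      by (subst (2) nn_integral_real_affine[where c = 1 and t = "- (real k * T)"]) auto
  qed
  also have "\<dots> = (\<Sum>k. ?e k) * cycle_cost f \<tau>"
    by simp
  finally show ?thesis .
qed

lemma restart_factor:
  assumes "0 < T"
  shows "(\<Sum>k. ennreal (exp (- (rate * (real k * T))))) = ennreal (1 / (1 - exp (- (rate * T))))"
proof -
  have pow: "exp (- (rate * (real k * T))) = exp (- (rate * T)) ^ k" for k
    by (simp add: mult_ac flip: exp_of_nat_mult)
  have "(\<lambda>k. exp (- (rate * T)) ^ k) sums (1 / (1 - exp (- (rate * T))))"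
    using assms rate_pos by (intro geometric_sums) simp
  then show ?thesis
    unfolding pow by (intro suminf_ennreal_eq) simp
qed

section \<open>The five policies\<close>

lemma AE_less_arrival_time:
  "AE \<omega> in M. \<forall>u\<ge>0. u < arrival_time N n \<omega> \<longleftrightarrow> N u \<omega> < n"
  using AE_count_unbounded AE_space
proof eventually_elim
  case (elim \<omega>)
  then obtain k :: nat where "n \<le> N (real k) \<omega>" by blast
  from arrival_time_le_iff[OF elim(2) _ this] show ?case by (auto simp flip: not_le)
qed

text \<open>
  Since \<open>T\<close> times the number \<open>nat \<lfloor>u / T\<rfloor>\<close> of completed periods is the last period end up to \<open>u\<close>, and
  the load is monotone and vanishes at time \<open>0\<close>, the first loaded period is still to come precisely if the
  load is zero there.
\<close>

lemma AE_less_loaded_period: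
  assumes T: "0 < T"
  shows "AE \<omega> in M. \<forall>u\<ge>0. u < real (first_loaded_period N T \<omega>) * T \<longleftrightarrow> N (real (nat \<lfloor>u / T\<rfloor>) * T) \<omega> = 0"
  using AE_count_unbounded AE_space
proof eventually_elim
  case (elim \<omega>)
  define K where "K = first_loaded_period N T \<omega>"
  from elim obtain k :: nat where k: "1 \<le> N (real k) \<omega>" by blast
  define j where "j = Suc (nat \<lceil>real k / T\<rceil>)"
  have "real k / T \<le> real j" unfolding j_def by linarith
  then have "real k \<le> real j * T" using T by (simp add: field_simps)
  then have "N (real k) \<omega> \<le> N (real j * T) \<omega>" using elim by (intro count_mono) auto
  with k have "1 \<le> j \<and> 1 \<le> N (real j * T) \<omega>" by (simp add: j_def)
  then have K: "1 \<le> K \<and> 1 \<le> N (real K * T) \<omega>"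
    unfolding K_def first_loaded_period_def by (rule LeastI)
  have less: "i < K \<longleftrightarrow> N (real i * T) \<omega> = 0" for i
  proof
    assume "i < K"
    then have "\<not> (1 \<le> i \<and> 1 \<le> N (real i * T) \<omega>)"
      unfolding K_def first_loaded_period_def by (rule not_less_Least)
    then show "N (real i * T) \<omega> = 0"
      using count_zero elim by (cases "i = 0") auto
  next
    assume i: "N (real i * T) \<omega> = 0"
    show "i < K"
    proof (rule ccontr)
      assume "\<not> i < K"
      then have "N (real K * T) \<omega> \<le> N (real i * T) \<omega>"
        using elim T by (intro count_mono mult_right_mono) auto
      with K i show False by simp
    qed
  qed
  show ?case
  proof (intro allI impI)
    fix u :: real assume u: "0 \<le> u"
    have "u < real K * T \<longleftrightarrow> \<lfloor>u / T\<rfloor> < int K"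
      using T by (simp add: floor_less_iff pos_divide_less_eq)
    also have "\<dots> \<longleftrightarrow> nat \<lfloor>u / T\<rfloor> < K"
      using u T K by linarith
    also have "\<dots> \<longleftrightarrow> N (real (nat \<lfloor>u / T\<rfloor>) * T) \<omega> = 0" by (rule less)
    finally show "u < real (first_loaded_period N T \<omega>) * T \<longleftrightarrow> N (real (nat \<lfloor>u / T\<rfloor>) * T) \<omega> = 0"
      unfolding K_def .
  qed
qed

lemma measurable_first_loaded_period [measurable]:
  assumes "0 < T"
  shows "first_loaded_period N T \<in> measurable M (count_space UNIV)"
proof -
  have [measurable]: "N (real k * T) \<in> measurable M (count_space UNIV)" for k :: nat
    using assms by (intro random_variable_count) simp
  show ?thesis
    unfolding first_loaded_period_def[abs_def] by measurable
qed

lemma measurable_policies: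
  assumes T: "0 < T"
  shows "QP N q \<in> borel_measurable M" "TP1 T \<in> borel_measurable M" "HP1 N q T \<in> borel_measurable M"
    "RTP1 N T \<in> borel_measurable M" "RHP1 N q T \<in> borel_measurable M"
proof -
  have [measurable]: "(\<lambda>\<omega>. real (first_loaded_period N T \<omega>)) \<in> borel_measurable M"
    by (rule measurable_compose[OF measurable_first_loaded_period[OF T]]) simp
  show "QP N q \<in> borel_measurable M" "TP1 T \<in> borel_measurable M" "HP1 N q T \<in> borel_measurable M"
    "RTP1 N T \<in> borel_measurable M" "RHP1 N q T \<in> borel_measurable M"
    unfolding QP_def[abs_def] TP1_def[abs_def] HP1_def[abs_def] RTP1_def[abs_def] RHP1_def[abs_def]
    by measurable
qed

lemma cycle_cost_one: "cycle_cost (\<lambda>_. 1) \<tau> = (\<integral>\<^sup>+\<omega>. ennreal (\<tau> \<omega>) \<partial>M)"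
  unfolding cycle_cost_def by (intro nn_integral_cong) (simp add: emeasure_lborel_Icc_eq ennreal_neg)

lemma AOD_eq_cycle_cost: "AOD M rate N \<tau> = cycle_cost (\<lambda>n. ennreal (real n)) \<tau> / (ennreal rate * cycle_cost (\<lambda>_. 1) \<tau>)"
  unfolding AOD_def cycle_cost_one by (simp only: cycle_cost_def)

lemma clearing_policy_iff_cycle_cost:
  "clearing_policy M \<tau> \<longleftrightarrow> \<tau> \<in> borel_measurable M \<and> 0 < cycle_cost (\<lambda>_. 1) \<tau> \<and> cycle_cost (\<lambda>_. 1) \<tau> < \<infinity>"
  unfolding clearing_policy_def cycle_cost_one ..

lemma cycle_cost_QP: "cycle_cost f (QP N q) = (\<Sum>n<q. f n * ennreal (1 / rate))"
proof -
  have "AE \<omega> in M. \<forall>u\<ge>0. u < QP N q \<omega> \<longleftrightarrow> u \<in> {0..} \<and> N u \<omega> \<in> {..<q}"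
    using AE_less_arrival_time[of q] by eventually_elim (simp add: QP_def)
  from cycle_cost_occupation[OF _ _ _ this, of f]
  have "cycle_cost f (QP N q) = (\<Sum>n. f n * indicator {..<q} n * ennreal (1 / rate))"
    by (simp add: occupation_time_total QP_def[abs_def])
  also have "\<dots> = (\<Sum>n<q. f n * ennreal (1 / rate))"
    by (subst suminf_finite[of "{..<q}"]) auto
  finally show ?thesis .
qed

lemma cycle_cost_HP1:
  assumes T: "0 < T"
  shows "cycle_cost f (HP1 N q T) = (\<Sum>n<q. f n * ennreal (erlang_CDF n rate T / rate))"
proof -
  have "AE \<omega> in M. \<forall>u\<ge>0. u < HP1 N q T \<omega> \<longleftrightarrow> u \<in> {0..<T} \<and> N u \<omega> \<in> {..<q}"
    using AE_less_arrival_time[of q] by eventually_elim (auto simp: HP1_def)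
  then have "cycle_cost f (HP1 N q T) = (\<Sum>n. f n * indicator {..<q} n * ennreal (erlang_CDF n rate T / rate))"
    unfolding occupation_time_before[symmetric]
    by (intro cycle_cost_occupation measurable_policies T) auto
  also have "\<dots> = (\<Sum>n<q. f n * ennreal (erlang_CDF n rate T / rate))"
    by (subst suminf_finite[of "{..<q}"]) auto
  finally show ?thesis .
qed

lemma cycle_cost_TP1:
  assumes T: "0 < T"
  shows "cycle_cost f (TP1 T) = (\<Sum>n. f n * ennreal (erlang_CDF n rate T / rate))"
proof -
  have "cycle_cost f (TP1 T) = (\<Sum>n. f n * indicator UNIV n * ennreal (erlang_CDF n rate T / rate))"
    unfolding occupation_time_before[symmetric]
    by (intro cycle_cost_occupation measurable_policies T) (auto simp: TP1_def)
  then show ?thesis by simp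
qed

lemma cycle_cost_RHP1:
  assumes T: "0 < T"
  shows "cycle_cost f (RHP1 N q T) = ennreal (1 / (1 - exp (- (rate * T)))) * cycle_cost f (HP1 N q T)"
proof -
  have "AE \<omega> in M. \<forall>u\<ge>0. u < HP1 N q T \<omega> \<longleftrightarrow> u < T \<and> N u \<omega> \<in> {..<q}"
    using AE_less_arrival_time[of q] by eventually_elim (auto simp: HP1_def)
  moreover have "AE \<omega> in M. \<forall>u\<ge>0. u < RHP1 N q T \<omega> \<longleftrightarrow>
      N (real (nat \<lfloor>u / T\<rfloor>) * T) \<omega> = 0 \<and> N u \<omega> \<in> {..<q}"
    using AE_less_arrival_time[of q] AE_less_loaded_period[OF T]
    by eventually_elim (auto simp: RHP1_def)
  ultimately show ?thesis
    unfolding restart_factor[OF T, symmetric]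
    by (intro cycle_cost_restart[OF T] measurable_policies T)
qed

lemma cycle_cost_RTP1:
  assumes T: "0 < T"
  shows "cycle_cost f (RTP1 N T) = ennreal (1 / (1 - exp (- (rate * T)))) * cycle_cost f (TP1 T)"
proof -
  have "AE \<omega> in M. \<forall>u\<ge>0. u < TP1 T \<omega> \<longleftrightarrow> u < T \<and> N u \<omega> \<in> UNIV"
    by (simp add: TP1_def)
  moreover have "AE \<omega> in M. \<forall>u\<ge>0. u < RTP1 N T \<omega> \<longleftrightarrow>
      N (real (nat \<lfloor>u / T\<rfloor>) * T) \<omega> = 0 \<and> N u \<omega> \<in> UNIV"
    using AE_less_loaded_period[OF T] by eventually_elim (auto simp: RTP1_def)
  ultimately show ?thesis
    unfolding restart_factor[OF T, symmetric]
    by (intro cycle_cost_restart[OF T] measurable_policies T)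
qed

lemma erlang_CDF_Suc_less:
  assumes T: "0 < T"
  shows "erlang_CDF (Suc n) rate T < erlang_CDF n rate T"
  using T rate_pos by (simp add: erlang_CDF_def del: fact_Suc)

lemma erlang_CDF_pos:
  assumes T: "0 < T"
  shows "0 < erlang_CDF n rate T"
  using erlang_CDF_Suc_less[OF T, of n] erlang_CDF_nonneg[OF rate_pos, of "Suc n" T] by simp

text \<open>
  This is \<open>\<Sum>n. P(N T > n) = E (N T)\<close>. It follows by adding up the expected times spent at all loads before
  \<open>T\<close>, which make up the whole of \<open>T\<close>.
\<close>

lemma sums_erlang_CDF:
  assumes T: "0 < T"
  shows "(\<lambda>n. erlang_CDF n rate T) sums (rate * T)"
proof -
  have eq: "ennreal T = (\<Sum>n. ennreal (erlang_CDF n rate T / rate))"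
    using cycle_cost_TP1[OF T, of "\<lambda>_. 1"] by (simp add: cycle_cost_one TP1_def emeasure_space_1)
  have nn: "0 \<le> erlang_CDF n rate T / rate" for n
    using erlang_CDF_pos[OF T, of n] rate_pos by simp
  have summ: "summable (\<lambda>n. erlang_CDF n rate T / rate)"
    using nn by (rule summable_suminf_not_top) (simp flip: eq)
  with eq nn have "ennreal T = ennreal (\<Sum>n. erlang_CDF n rate T / rate)"
    by (simp add: suminf_ennreal2)
  then have "T = (\<Sum>n. erlang_CDF n rate T / rate)"
    using T by (subst (asm) ennreal_inj) (auto intro!: suminf_nonneg summ nn)
  with summable_sums[OF summ] have "(\<lambda>n. erlang_CDF n rate T / rate) sums T" by simp
  from sums_mult[OF this, of rate] show ?thesis using rate_pos by simp
qed

section \<open>Comparison of the average order delays\<close>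

lemma AOD_HP1:
  assumes T: "0 < T" and q: "1 \<le> q"
  shows "AOD M rate N (HP1 N q T) =
    ennreal ((\<Sum>n<q. real n * erlang_CDF n rate T) / (rate * (\<Sum>n<q. erlang_CDF n rate T)))"
proof -
  note pos = erlang_CDF_pos[OF T]
  have B: "0 < (\<Sum>n<q. erlang_CDF n rate T)" using q by (intro sum_pos pos) (auto simp: lessThan_empty_iff)
  have A: "0 \<le> (\<Sum>n<q. real n * erlang_CDF n rate T)" using pos by (intro sum_nonneg) (simp add: less_imp_le)
  have c1: "cycle_cost (\<lambda>_. 1) (HP1 N q T) = ennreal ((\<Sum>n<q. erlang_CDF n rate T) / rate)"
    unfolding cycle_cost_HP1[OF T] using pos rate_pos
    by (simp add: sum_ennreal less_imp_le sum_divide_distrib)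
  have c2: "cycle_cost (\<lambda>n. ennreal (real n)) (HP1 N q T) = ennreal ((\<Sum>n<q. real n * erlang_CDF n rate T) / rate)"
    unfolding cycle_cost_HP1[OF T] using pos rate_pos
    by (simp add: sum_ennreal less_imp_le sum_divide_distrib flip: ennreal_mult)
  show ?thesis
    unfolding AOD_eq_cycle_cost c1 c2 using rate_pos A B
    by (simp add: divide_ennreal flip: ennreal_mult)
qed

lemma AOD_HP1_less_QP:
  assumes T: "0 < T" and q: "2 \<le> q"
  shows "AOD M rate N (HP1 N q T) < AOD M rate N (QP N q)"
proof -
  let ?t = "\<lambda>n. erlang_CDF n rate T"
  have B: "0 < (\<Sum>n<q. ?t n)"
    using q by (intro sum_pos erlang_CDF_pos[OF T]) (auto simp: lessThan_empty_iff)
  have less: "2 * (\<Sum>n<q. real n * ?t n) < (real q - 1) * (\<Sum>n<q. ?t n)"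
    using erlang_CDF_Suc_less[OF T] q by (rule sum_index_strict_antimono)
  have gauss: "(\<Sum>n<q. real n) = real q * (real q - 1) / 2"
    by (induction q) (simp_all add: field_simps)
  have c1: "cycle_cost (\<lambda>_. 1) (QP N q) = ennreal (real q / rate)"
    unfolding cycle_cost_QP using rate_pos by (simp add: ennreal_of_nat_eq_real_of_nat flip: ennreal_mult)
  have c2: "cycle_cost (\<lambda>n. ennreal (real n)) (QP N q) = ennreal (real q * (real q - 1) / 2 / rate)"
    unfolding cycle_cost_QP gauss[symmetric] using rate_pos
    by (simp add: sum_ennreal sum_divide_distrib flip: ennreal_mult)
  have "AOD M rate N (QP N q) = ennreal ((real q - 1) / (2 * rate))"
    unfolding AOD_eq_cycle_cost c1 c2 using rate_pos q
    by (simp add: divide_ennreal flip: ennreal_mult)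
  moreover have "(\<Sum>n<q. real n * ?t n) / (rate * (\<Sum>n<q. ?t n)) < (real q - 1) / (2 * rate)"
    using less B rate_pos by (simp add: divide_simps mult_ac)
  ultimately show ?thesis
    using q T by (simp add: AOD_HP1 ennreal_less_iff sum_nonneg erlang_CDF_pos[OF T] less_imp_le rate_pos)
qed

text \<open>
  The average for TP1 is bounded below by replacing the loads \<open>n > q\<close> by \<open>q\<close>. The weighted
  sum of the loads is then \<open>S = A + q * (L - B)\<close>, where \<open>L = rate * T\<close> is the sum of all weights, and \<open>A / B < S / L\<close>
  amounts to \<open>A < q * B\<close> because \<open>B < L\<close>.
\<close>

lemma AOD_HP1_less_TP1:
  assumes T: "0 < T" and q: "1 \<le> q"
  shows "AOD M rate N (HP1 N q T) < AOD M rate N (TP1 T)"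
proof -
  define t where "t n = erlang_CDF n rate T" for n
  have pos: "0 < t n" for n unfolding t_def by (rule erlang_CDF_pos[OF T])
  define A B where "A = (\<Sum>n<q. real n * t n)" and "B = (\<Sum>n<q. t n)"
  have sums: "t sums (rate * T)" unfolding t_def using sums_erlang_CDF[OF T] .
  have B: "0 < B" unfolding B_def using q by (intro sum_pos pos) (auto simp: lessThan_empty_iff)
  have A0: "0 \<le> A" unfolding A_def using pos by (intro sum_nonneg) (simp add: less_imp_le)
  have "A \<le> (\<Sum>n<q. (real q - 1) * t n)"
    unfolding A_def using pos by (intro sum_mono mult_right_mono) (auto simp: less_imp_le)
  also have "\<dots> = (real q - 1) * B" by (simp only: B_def sum_distrib_left)
  also have "\<dots> < real q * B" using B by simp
  finally have AB: "A < real q * B" .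
  have BL: "B < rate * T"
    unfolding B_def sums_unique[OF sums] using pos
    by (intro sum_less_suminf sums_summable[OF sums]) auto
  define S where "S = A + real q * (rate * T - B)"
  have S: "(\<lambda>n. real (min n q) * t n) sums S"
  proof -
    have "(\<lambda>n. if n \<in> {..<q} then (real n - real q) * t n else 0) sums (\<Sum>n<q. (real n - real q) * t n)"
      by (rule sums_If_finite_set) simp
    from sums_add[OF this sums_mult[OF sums, of "real q"]]
    have "(\<lambda>n. (if n \<in> {..<q} then (real n - real q) * t n else 0) + real q * t n) sums
      ((\<Sum>n<q. (real n - real q) * t n) + real q * (rate * T))" .
    also have "(\<lambda>n. (if n \<in> {..<q} then (real n - real q) * t n else 0) + real q * t n) =
        (\<lambda>n. real (min n q) * t n)"
      by (auto simp: algebra_simps)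
    also have "(\<Sum>n<q. (real n - real q) * t n) + real q * (rate * T) = S"
      by (simp add: S_def A_def B_def sum_subtractf left_diff_distrib right_diff_distrib flip: sum_distrib_left)
    finally show ?thesis .
  qed
  have S0: "0 \<le> S" unfolding S_def using A0 BL by simp
  have "S * B - A * (rate * T) = (real q * B - A) * (rate * T - B)"
    by (simp add: S_def algebra_simps)
  also have "\<dots> > 0" using AB BL by simp
  finally have "A / (rate * B) < S / (rate * (rate * T))"
    using B rate_pos T by (simp add: divide_simps mult_ac)
  then have "ennreal (A / (rate * B)) < ennreal (S / (rate * (rate * T)))"
    using A0 B rate_pos by (simp add: ennreal_less_iff)
  also have "\<dots> = ennreal (S / rate) / (ennreal rate * cycle_cost (\<lambda>_. 1) (TP1 T))"
    using T rate_pos S0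
    by (simp add: cycle_cost_one TP1_def emeasure_space_1 divide_ennreal flip: ennreal_mult)
  also have "\<dots> \<le> AOD M rate N (TP1 T)"
    unfolding AOD_eq_cycle_cost
  proof (rule divide_right_mono_ennreal)
    have "ennreal (S / rate) = (\<Sum>n. ennreal (real (min n q) * t n / rate))"
      using pos rate_pos by (intro suminf_ennreal_eq[symmetric] sums_divide S) (simp add: less_imp_le)
    also have "\<dots> \<le> (\<Sum>n. ennreal (real n) * ennreal (t n / rate))"
      using pos rate_pos
      by (intro suminf_le summableI)
         (auto simp: less_imp_le simp flip: ennreal_mult intro!: ennreal_leI divide_right_mono mult_right_mono)
    also have "\<dots> = cycle_cost (\<lambda>n. ennreal (real n)) (TP1 T)"
      by (simp add: cycle_cost_TP1[OF T] t_def)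
    finally show "ennreal (S / rate) \<le> cycle_cost (\<lambda>n. ennreal (real n)) (TP1 T)" .
  qed
  finally show ?thesis using T q by (simp add: AOD_HP1 A_def B_def t_def)
qed

lemma restart_factor_bounds:
  assumes "0 < T"
  shows "ennreal (1 / (1 - exp (- (rate * T)))) \<noteq> 0" "ennreal (1 / (1 - exp (- (rate * T)))) \<noteq> \<infinity>"
  using assms rate_pos by (simp_all add: ennreal_eq_0_iff not_le)

text \<open>
  A factor common to both costs has to be neither \<open>0\<close> nor \<open>\<infinity>\<close> in order to cancel in the extended
  quotient.
\<close>

lemma AOD_scale:
  assumes c: "c \<noteq> 0" "c \<noteq> \<infinity>" and eq: "\<And>f. cycle_cost f \<tau>' = c * cycle_cost f \<tau>"
  shows "AOD M rate N \<tau>' = AOD M rate N \<tau>"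
  unfolding AOD_eq_cycle_cost eq
  using divide_mult_eq[OF c, of "cycle_cost (\<lambda>n. ennreal (real n)) \<tau>" "ennreal rate * cycle_cost (\<lambda>_. 1) \<tau>"]
  by (simp add: mult_ac)

lemma clearing_policies:
  assumes T: "0 < T" and q: "1 \<le> q"
    and \<tau>: "\<tau> \<in> {QP N q, TP1 T, HP1 N q T, RTP1 N T, RHP1 N q T}"
  shows "clearing_policy M \<tau>"
proof -
  have TP1: "0 < cycle_cost (\<lambda>_. 1) (TP1 T) \<and> cycle_cost (\<lambda>_. 1) (TP1 T) < \<infinity>"
    using T by (simp add: cycle_cost_one TP1_def emeasure_space_1)
  have QP: "0 < cycle_cost (\<lambda>_. 1) (QP N q) \<and> cycle_cost (\<lambda>_. 1) (QP N q) < \<infinity>"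
    using q rate_pos by (simp add: cycle_cost_QP ennreal_zero_less_mult_iff ennreal_mult_less_top of_nat_less_top)
  have HP1: "0 < cycle_cost (\<lambda>_. 1) (HP1 N q T) \<and> cycle_cost (\<lambda>_. 1) (HP1 N q T) < \<infinity>"
  proof -
    have "0 < (\<Sum>n<q. erlang_CDF n rate T / rate)"
      using q rate_pos by (intro sum_pos divide_pos_pos erlang_CDF_pos[OF T]) (auto simp: lessThan_empty_iff)
    then show ?thesis
      using erlang_CDF_pos[OF T] rate_pos by (simp add: cycle_cost_HP1[OF T] sum_ennreal less_imp_le)
  qed
  note c = restart_factor_bounds[OF T]
  have scale: "0 < c * x \<and> c * x < \<infinity>" if "c \<noteq> 0" "c \<noteq> \<infinity>" "0 < x \<and> x < \<infinity>" for c x :: ennreal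
    using that by (simp add: ennreal_zero_less_mult_iff ennreal_mult_less_top less_top zero_less_iff_neq_zero)
  show ?thesis
    using \<tau> TP1 QP HP1 scale[OF c TP1] scale[OF c HP1] measurable_policies[OF T]
    unfolding clearing_policy_iff_cycle_cost by (auto simp only: cycle_cost_RHP1[OF T] cycle_cost_RTP1[OF T] insert_iff empty_iff)
qed

end

theorem mainTheorem12:
  fixes M :: "'a measure" and rate :: real and N :: "real \<Rightarrow> 'a \<Rightarrow> nat"
    and q :: nat and T :: real
  assumes "poisson_process M rate N"
    and "1 \<le> q"
    and "0 < T"
  shows "(\<forall>\<tau> \<in> {QP N q, TP1 T, HP1 N q T, RTP1 N T, RHP1 N q T}. clearing_policy M \<tau>) \<and>
    AOD M rate N (RHP1 N q T) = AOD M rate N (HP1 N q T) \<and>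
    AOD M rate N (RTP1 N T) = AOD M rate N (TP1 T) \<and>
    (2 \<le> q \<longrightarrow> AOD M rate N (RHP1 N q T) < AOD M rate N (QP N q)) \<and>
    AOD M rate N (RHP1 N q T) < AOD M rate N (RTP1 N T)"
proof -
  interpret poisson_process M rate N by fact
  note q = \<open>1 \<le> q\<close> and T = \<open>0 < T\<close>
  have RHP1: "AOD M rate N (RHP1 N q T) = AOD M rate N (HP1 N q T)"
    by (rule AOD_scale[OF restart_factor_bounds[OF T] cycle_cost_RHP1[OF T]])
  have RTP1: "AOD M rate N (RTP1 N T) = AOD M rate N (TP1 T)"
    by (rule AOD_scale[OF restart_factor_bounds[OF T] cycle_cost_RTP1[OF T]])
  show ?thesis
    unfolding RHP1 RTP1
    using clearing_policies[OF T q] AOD_HP1_less_QP[OF T] AOD_HP1_less_TP1[OF T q] by blast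
qed

end
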